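(* Let $\ell\ge2$, let $\mathfrak{h}$ be a Lie subalgebra of $\mathfrak{sp}(\ell)$, and let $\phi$ be the standard representation of $\mathfrak{sp}(\ell)$ (highest weight $(1,0,\ldots,0)$, dimension $2\ell$). The following are equivalent: (a) $\mathfrak{h}=\mathfrak{sp}(\ell)$; (b) $(\mathrm{Sym}^2\phi)|_{\mathfrak{h}}$ is irreducible; (c) $(\mathrm{Sym}^2\phi)|_{\mathfrak{h}}$ is irreducible, $(\mathrm{Alt}^2\phi)|_{\mathfrak{h}}$ splits into two irreducible components, and no irreducible component (of $(\phi\otimes\phi)|_{\mathfrak{h}}$) occurs more than once; (d) $(\phi\otimes\phi)|_{\mathfrak{h}}$ splits into three pairwise inequivalent irreducible components; (e) the vector space of all complex matrices commuting with $(\phi\otimes\phi)(h)$ for all $h\in\mathfrak{h}$ has dimension three.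
   Context: $\mathfrak{sp}(\ell)=\mathfrak{sp}(2\ell,\mathbb C)\cap\mathfrak{su}(2\ell)$, realized as matrices acting on $V=\mathbb C^{2\ell}$ (the standard representation). $\phi\otimes\phi$ acts on $V\otimes V$ by $\phi(g)\otimes\mathbb 1+\mathbb 1\otimes\phi(g)$; $\mathrm{Alt}^2\phi$ and $\mathrm{Sym}^2\phi$ are its restrictions to the antisymmetric and symmetric subspaces of $V\otimes V$, so $\phi\otimes\phi=\mathrm{Alt}^2\phi\oplus\mathrm{Sym}^2\phi$. Irreducibility is over $\mathbb C$. *)

theory Defs
  imports "HOL-Analysis.Analysis"
begin

text \<open>The standard representation space V = C^(2l) is indexed by the type bool \<times> 'l,
  where l = CARD('l).  The index (True, i) is the i-th coordinate of the first block,
  (False, i) the i-th coordinate of the second block.  V \<otimes> V is indexed by pairs of indices.\<close>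

type_synonym 'l idx = "bool \<times> 'l"
type_synonym 'l sqmat = "complex ^ ('l idx) ^ ('l idx)"
type_synonym 'l tvec = "complex ^ ('l idx \<times> 'l idx)"
type_synonym 'l tmat = "complex ^ ('l idx \<times> 'l idx) ^ ('l idx \<times> 'l idx)"

text \<open>Standard symplectic form J = [[0, I], [-I, 0]].\<close>
definition Jmat :: "('l::finite) sqmat" where
  "Jmat = (\<chi> p q. if snd p = snd q then
             (if fst p \<and> \<not> fst q then 1 else if \<not> fst p \<and> fst q then -1 else 0)
           else 0)"

definition conj_transpose :: "complex ^ 'n ^ 'm \<Rightarrow> complex ^ 'm ^ 'n" where
  "conj_transpose A = (\<chi> i j. cnj (A $ j $ i))"

text \<open>sp(2l, C)\<close>
definition sp_complex :: "('l::finite) sqmat set" where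
  "sp_complex = {X. transpose X ** Jmat + Jmat ** X = 0}"

text \<open>su(2l)\<close>
definition su_alg :: "('l::finite) sqmat set" where
  "su_alg = {X. conj_transpose X = - X \<and> trace X = 0}"

text \<open>The compact symplectic Lie algebra sp(l) = sp(2l, C) \<inter> su(2l).\<close>
definition sp_alg :: "('l::finite) sqmat set" where
  "sp_alg = sp_complex \<inter> su_alg"

definition mat_scale :: "complex \<Rightarrow> complex ^ 'n ^ 'm \<Rightarrow> complex ^ 'n ^ 'm" where
  "mat_scale c A = (\<chi> i j. c * A $ i $ j)"

definition lie_bracket :: "complex ^ 'n ^ 'n \<Rightarrow> complex ^ 'n ^ 'n \<Rightarrow> complex ^ 'n ^ 'n" where
  "lie_bracket X Y = X ** Y - Y ** X"

text \<open>A (real) Lie subalgebra of sp(l).\<close>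
definition lie_subalgebra :: "('l::finite) sqmat set \<Rightarrow> bool" where
  "lie_subalgebra h \<longleftrightarrow> h \<subseteq> sp_alg \<and> 0 \<in> h
     \<and> (\<forall>X\<in>h. \<forall>Y\<in>h. X + Y \<in> h)
     \<and> (\<forall>r::real. \<forall>X\<in>h. mat_scale (complex_of_real r) X \<in> h)
     \<and> (\<forall>X\<in>h. \<forall>Y\<in>h. lie_bracket X Y \<in> h)"

text \<open>(phi \<otimes> phi)(X) = X \<otimes> 1 + 1 \<otimes> X acting on V \<otimes> V.\<close>
definition tensor_act :: "('l::finite) sqmat \<Rightarrow> 'l tmat" where
  "tensor_act X = (\<chi> p q. (if snd p = snd q then X $ fst p $ fst q else 0)
                        + (if fst p = fst q then X $ snd p $ snd q else 0))"

definition sym_space :: "('l::finite) tvec set" where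
  "sym_space = {v. \<forall>i j. v $ (i, j) = v $ (j, i)}"

definition alt_space :: "('l::finite) tvec set" where
  "alt_space = {v. \<forall>i j. v $ (i, j) = - v $ (j, i)}"

text \<open>Representation theory of a set S of operators (complex matrices) on complex^'k.
  Subspaces are complex subspaces.\<close>

definition invariant :: "(complex ^ 'k ^ 'k) set \<Rightarrow> (complex ^ 'k) set \<Rightarrow> bool" where
  "invariant S W \<longleftrightarrow> (\<forall>A\<in>S. \<forall>w\<in>W. A *v w \<in> W)"

definition subrep :: "(complex ^ 'k ^ 'k) set \<Rightarrow> (complex ^ 'k) set \<Rightarrow> bool" where
  "subrep S W \<longleftrightarrow> vec.subspace W \<and> invariant S W"

definition irreducible_rep :: "(complex ^ 'k ^ 'k) set \<Rightarrow> (complex ^ 'k) set \<Rightarrow> bool" where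
  "irreducible_rep S W \<longleftrightarrow> subrep S W \<and> W \<noteq> {0}
     \<and> (\<forall>U. subrep S U \<and> U \<subseteq> W \<longrightarrow> U = {0} \<or> U = W)"

text \<open>Equivalence of two subrepresentations: a linear isomorphism intertwining the action.\<close>
definition equivalent_rep :: "(complex ^ 'k ^ 'k) set \<Rightarrow> (complex ^ 'k) set \<Rightarrow> (complex ^ 'k) set \<Rightarrow> bool" where
  "equivalent_rep S W1 W2 \<longleftrightarrow> (\<exists>T. Vector_Spaces.linear (*s) (*s) T \<and> bij_betw T W1 W2
     \<and> (\<forall>A\<in>S. \<forall>w\<in>W1. T (A *v w) = A *v T w))"

text \<open>W is the (internal) direct sum of the n irreducible subrepresentations Ws 0, ..., Ws (n-1).\<close>
definition decomposes_into :: "(complex ^ 'k ^ 'k) set \<Rightarrow> (complex ^ 'k) set \<Rightarrow> (nat \<Rightarrow> (complex ^ 'k) set) \<Rightarrow> nat \<Rightarrow> bool" where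
  "decomposes_into S W Ws n \<longleftrightarrow>
     (\<forall>i<n. irreducible_rep S (Ws i) \<and> Ws i \<subseteq> W)
     \<and> (\<forall>w\<in>W. \<exists>!f. (\<forall>i<n. f i \<in> Ws i) \<and> (\<forall>i\<ge>n. f i = 0) \<and> w = (\<Sum>i<n. f i))"

definition pairwise_inequivalent :: "(complex ^ 'k ^ 'k) set \<Rightarrow> (nat \<Rightarrow> (complex ^ 'k) set) \<Rightarrow> nat \<Rightarrow> bool" where
  "pairwise_inequivalent S Ws n \<longleftrightarrow> (\<forall>i<n. \<forall>j<n. i \<noteq> j \<longrightarrow> \<not> equivalent_rep S (Ws i) (Ws j))"

text \<open>The commutant: all complex matrices commuting with every operator of S.\<close>
definition commutant :: "(complex ^ 'k ^ 'k) set \<Rightarrow> (complex ^ 'k ^ 'k) set" where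
  "commutant S = {M. \<forall>A\<in>S. M ** A = A ** M}"

text \<open>Identify complex k\<times>k matrices with vectors in complex^('k\<times>'k) to measure complex dimension.\<close>
definition mat_flat :: "complex ^ 'k ^ 'k \<Rightarrow> complex ^ ('k \<times> 'k)" where
  "mat_flat M = (\<chi> p. M $ fst p $ snd p)"

definition mat_space_dim :: "(complex ^ 'k ^ 'k) set \<Rightarrow> nat" where
  "mat_space_dim C = vec.dim (mat_flat ` C)"

end

theory Submission
  imports Defs
begin

text \<open>Write \<open>\<omega>\<close> for the invariant vector of \<open>V \<otimes> V\<close> given by the symplectic form. The projections of \<open>V \<otimes> V\<close>
  onto the symmetric tensors, onto the antisymmetric tensors of vanishing contraction and onto the
  line of \<open>\<omega>\<close> always lie in the commutant.

  For \<open>sp(l)\<close> they span it: \<open>e\<^sub>a \<otimes> e\<^sub>b\<close>, with \<open>e\<^sub>b\<close> the symplectic partner of \<open>e\<^sub>a\<close>, is a cyclic vector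
  killed by the Cartan subalgebra and by a copy of \<open>sp(2l-2)\<close>, so a commuting matrix is determined by
  its value there, which is a combination of \<open>e\<^sub>a \<otimes> e\<^sub>b\<close>, \<open>e\<^sub>b \<otimes> e\<^sub>a\<close> and \<open>\<omega>\<close>. Hence (a) implies (e).

  If the commutant has dimension three, the three projections span it. As \<open>h\<close> acts by skew-Hermitian
  matrices, the orthogonal projection onto an invariant subspace commutes with \<open>h\<close>; this makes the three
  images irreducible, and an equivalence between two of them would be a commuting matrix outside
  the span. Hence (e) implies (b), (c) and (d).

  If (d) holds, strict chains of invariant subspaces have at most three steps, so the chain
  \<open>0 < Sym\<^sup>2 < Sym\<^sup>2 + \<langle>\<omega>\<rangle> < V \<otimes> V\<close> cannot be refined and (b) follows. Finally, \<open>Sym\<^sup>2\<close> is the adjoint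
  representation of \<open>sp(2l, C)\<close>, in which \<open>h + ih\<close> is an invariant subspace; so (b) forces
  \<open>h + ih = sp(2l, C)\<close>, and comparing skew-Hermitian parts gives (a).\<close>

section \<open>Commutants and irreducible representations\<close>

text \<open>Applying both sides to the basis vectors \<open>axis q 1\<close> recovers the entries,
  so linear relations between flattened matrices can be handled as identities between
  operators.\<close>

lemma mat_flat_combination_iff:
  "mat_flat M = (\<Sum>i\<in>I. c i *s mat_flat (P i)) \<longleftrightarrow> (\<forall>v. M *v v = (\<Sum>i\<in>I. c i *s (P i *v v)))"
    (is "?L \<longleftrightarrow> ?R")
proof
  assume ?L
  then have "M $ p $ q = (\<Sum>i\<in>I. c i * P i $ p $ q)" for p q
    by (auto simp: mat_flat_def vec_eq_iff)
  then have "(M *v v) $ p = (\<Sum>i\<in>I. c i *s (P i *v v)) $ p" for v p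
    by (simp add: matrix_vector_mult_def sum_distrib_right sum_distrib_left mult.assoc sum.swap[of _ I])
  then show ?R by (simp add: vec_eq_iff)
next
  assume R: ?R
  have *: "(N *v axis q 1) $ p = N $ p $ q" for N :: "complex^'a^'a" and p q
    by (simp add: matrix_vector_mult_def axis_def if_distrib cong: if_cong)
  have "M $ p $ q = (\<Sum>i\<in>I. c i * P i $ p $ q)" for p q
    using arg_cong[OF R[rule_format, of "axis q 1"], of "\<lambda>x. x $ p"] by (simp add: *)
  then show ?L by (simp add: mat_flat_def vec_eq_iff)
qed

lemma commutantD: "M \<in> commutant S \<Longrightarrow> A \<in> S \<Longrightarrow> M *v (A *v v) = A *v (M *v v)"
  by (simp add: commutant_def matrix_vector_mul_assoc)

lemma commutantI: "(\<And>A v. A \<in> S \<Longrightarrow> M *v (A *v v) = A *v (M *v v)) \<Longrightarrow> M \<in> commutant S"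
  by (simp add: commutant_def matrix_eq matrix_vector_mul_assoc)

lemma inner_complex_mult_left: "inner (c * a) (b::complex) = inner a (cnj c * b)"
  by (simp add: inner_complex_def algebra_simps)

lemma inner_vector_scale: "inner (c *s x) y = inner x (cnj c *s y)" for x y :: "complex^'k"
  by (simp add: inner_vec_def inner_complex_mult_left)

lemma uminus_matrix_vector_mult: "(- A) *v x = - (A *v x)" for A :: "complex^'k^'m"
  by (simp add: matrix_vector_mult_def vec_eq_iff sum_negf)

text \<open>The library's \<open>inner\<close> on complex vectors is the real part of the Hermitian
  product, and the usual adjoint rule survives taking real parts.\<close>

lemma inner_conj_transpose: "inner (A *v x) y = inner x (conj_transpose A *v y)" for x y :: "complex^'k"
proof -
  have "inner (A *v x) y = (\<Sum>i\<in>UNIV. \<Sum>j\<in>UNIV. inner (x $ j) (cnj (A $ i $ j) * y $ i))"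
    by (simp add: inner_vec_def matrix_vector_mult_def inner_sum_left inner_complex_mult_left)
  also have "\<dots> = inner x (conj_transpose A *v y)"
    by (subst sum.swap) (simp add: inner_vec_def matrix_vector_mult_def conj_transpose_def inner_sum_right)
  finally show ?thesis .
qed

text \<open>\<open>Q\<close> is the orthogonal projection onto \<open>U\<close>. Skew-Hermitian
  operators preserve the orthogonal complement of an invariant subspace as well, hence commute with
  \<open>Q\<close>.\<close>

lemma invariant_projection:
  fixes U :: "(complex^'k) set"
  assumes skew: "\<And>A. A \<in> S \<Longrightarrow> conj_transpose A = - A" and U: "subrep S U"
  obtains Q where "Q \<in> commutant S" "\<And>v. Q *v v \<in> U" "\<And>u. u \<in> U \<Longrightarrow> Q *v u = u"
proof -
  have sub: "vec.subspace U" and inv: "\<And>A u. A \<in> S \<Longrightarrow> u \<in> U \<Longrightarrow> A *v u \<in> U"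
    using U by (auto simp: subrep_def invariant_def)
  \<comment> \<open>\<open>U\<close> is viewed as a real subspace so that the real orthogonal
    decomposition applies.\<close>
  have "r *\<^sub>R x = complex_of_real r *s x" for r and x :: "complex^'k"
    unfolding vec_eq_iff vector_smult_component vector_scaleR_component
    by (simp add: scaleR_conv_of_real)
  then have "subspace U"
    using sub by (auto simp: subspace_def vec.subspace_def)
  then have sp: "span U = U" by simp
  \<comment> \<open>Since \<open>U\<close> is closed under complex scalars, the complement for the
    real inner product is itself a complex subspace, the Hermitian complement of
    \<open>U\<close>.\<close>
  define V where "V = {z. \<forall>w\<in>U. inner z w = 0}"
  have subV: "vec.subspace V"
    using sub by (auto simp: V_def vec.subspace_def inner_add_left inner_vector_scale)
  have invV: "A *v z \<in> V" if "A \<in> S" "z \<in> V" for A z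
    using that inv[OF that(1)]
    by (auto simp: V_def inner_conj_transpose skew uminus_matrix_vector_mult)
  have UV: "y = 0" if "y \<in> U" "y \<in> V" for y
    using that by (auto simp: V_def)
  have ex: "\<exists>y. y \<in> U \<and> x - y \<in> V" for x
  proof -
    obtain y z where "y \<in> span U" "\<And>w. w \<in> span U \<Longrightarrow> orthogonal z w" "x = y + z"
      using orthogonal_subspace_decomp_exists by blast
    then show ?thesis unfolding sp V_def orthogonal_def by (intro exI[of _ y]) auto
  qed
  define q where "q x = (SOME y. y \<in> U \<and> x - y \<in> V)" for x
  have q: "q x \<in> U" "x - q x \<in> V" for x
    using someI_ex[OF ex[of x]] by (auto simp: q_def)
  \<comment> \<open>Uniqueness of the decomposition makes the chosen \<open>q\<close> linear and
    lets it commute with \<open>S\<close>: in each case the expected value satisfies the two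
    defining conditions.\<close>
  have uniq: "q x = y" if "y \<in> U" "x - y \<in> V" for x y
  proof -
    have "q x - y \<in> U" using q that sub by (simp add: vec.subspace_diff)
    moreover have "(x - y) - (x - q x) \<in> V" using q that subV vec.subspace_diff by blast
    ultimately show ?thesis using UV[of "q x - y"] by simp
  qed
  have lin: "Vector_Spaces.linear (*s) (*s) q"
  proof (unfold_locales)
    show "q (x + y) = q x + q y" for x y
    proof (rule uniq)
      show "q x + q y \<in> U" using q sub by (simp add: vec.subspace_add)
      have "(x - q x) + (y - q y) \<in> V" using q subV vec.subspace_add by blast
      then show "x + y - (q x + q y) \<in> V" by (simp add: algebra_simps)
    qed
    show "q (c *s x) = c *s q x" for c x
    proof (rule uniq)
      show "c *s q x \<in> U" using q sub by (simp add: vec.subspace_scale)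
      have "c *s (x - q x) \<in> V" using q subV vec.subspace_scale by blast
      then show "c *s x - c *s q x \<in> V" by (simp add: vec.scale_right_diff_distrib)
    qed
  qed
  have mq: "matrix q *v v = q v" for v
    using lin by (simp add: matrix_works)
  show ?thesis
  proof
    show "matrix q \<in> commutant S"
    proof (rule commutantI)
      fix A v assume A: "A \<in> S"
      have "A *v v - A *v q v \<in> V" using invV[OF A q(2)[of v]] by (simp add: matrix_vector_mult_diff_distrib)
      then show "matrix q *v (A *v v) = A *v (matrix q *v v)"
        unfolding mq by (intro uniq inv A q)
    qed
    show "matrix q *v v \<in> U" for v by (simp add: mq q)
    show "matrix q *v u = u" if "u \<in> U" for u
      unfolding mq using that subV by (intro uniq) (auto simp: vec.subspace_0)
  qed
qed

section \<open>Orthogonal idempotents in a commutant\<close>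

text \<open>The idempotents may sum to the projection onto a proper subspace, so that the locale
  serves both for all of \<open>V \<otimes> V\<close> (\<open>n = 3\<close>) and for its
  antisymmetric part (\<open>n = 2\<close>).\<close>

locale invariant_idempotents =
  fixes S :: "(complex^'k^'k) set" and P :: "nat \<Rightarrow> complex^'k^'k" and n :: nat
  assumes comm: "i < n \<Longrightarrow> P i \<in> commutant S"
    and nonzero: "i < n \<Longrightarrow> P i \<noteq> 0"
    and idem: "i < n \<Longrightarrow> P i *v (P i *v v) = P i *v v"
    and orth: "i < n \<Longrightarrow> j < n \<Longrightarrow> i \<noteq> j \<Longrightarrow> P i *v (P j *v v) = 0"
begin

lemma apply_combination:
  "j < n \<Longrightarrow> P j *v (\<Sum>i<n. c i *s (P i *v v)) = c j *s (P j *v v)"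
proof -
  assume j: "j < n"
  have "P j *v (\<Sum>i<n. c i *s (P i *v v)) = (\<Sum>i<n. c i *s (P j *v (P i *v v)))"
    by (simp add: vec.sum vec.scale)
  also have "\<dots> = (\<Sum>i<n. if i = j then c j *s (P j *v v) else 0)"
    using j by (intro sum.cong) (auto simp: idem orth)
  finally show ?thesis using j by simp
qed

lemma combination_apply:
  "j < n \<Longrightarrow> (\<Sum>i<n. c i *s (P i *v (P j *v v))) = c j *s (P j *v v)"
proof -
  assume j: "j < n"
  have "(\<Sum>i<n. c i *s (P i *v (P j *v v))) = (\<Sum>i<n. if i = j then c j *s (P j *v v) else 0)"
    using j by (intro sum.cong) (auto simp: idem orth)
  then show ?thesis using j by simp
qed

lemma nonzero_vector: "i < n \<Longrightarrow> \<exists>v. P i *v v \<noteq> 0"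
  using nonzero[of i] matrix_eq[of "P i" 0] by auto

lemma combination_unique:
  assumes "(\<Sum>i<n. c i *s mat_flat (P i)) = 0" "i < n"
  shows "c i = 0"
proof -
  obtain v where v: "P i *v v \<noteq> 0" using nonzero_vector assms by blast
  have "mat_flat 0 = (\<Sum>i<n. c i *s mat_flat (P i))"
    using assms by (simp add: mat_flat_def vec_eq_iff)
  then have "(\<Sum>i<n. c i *s (P i *v v)) = 0"
    by (simp add: mat_flat_combination_iff)
  then have "c i *s (P i *v v) = 0" using apply_combination[OF assms(2), of c v] by simp
  then show ?thesis using v by simp
qed

lemma inj_flat: "inj_on (\<lambda>i. mat_flat (P i)) {..<n}"
proof (rule inj_onI, rule ccontr)
  fix i j assume ij: "i \<in> {..<n}" "j \<in> {..<n}" "mat_flat (P i) = mat_flat (P j)" "i \<noteq> j"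
  \<comment> \<open>Equal members would satisfy the nontrivial relation with coefficient 1 at
    \<open>i\<close> and -1 at \<open>j\<close>.\<close>
  have "(\<Sum>k<n. ((if k = i then 1 else 0) - (if k = j then 1 else 0)) *s mat_flat (P k))
     = mat_flat (P i) - mat_flat (P j)"
    using ij by (simp add: vec.scale_left_diff_distrib sum_subtractf if_distrib[of "\<lambda>c. c *s _"] cong: if_cong)
  then show False using combination_unique[of "\<lambda>k. (if k = i then 1 else 0) - (if k = j then 1 else 0)" i] ij by simp
qed

lemma independent_flat: "vec.independent ((\<lambda>i. mat_flat (P i)) ` {..<n})"
proof (rule vec.independent_if_scalars_zero)
  fix f x assume s: "(\<Sum>x\<in>(\<lambda>i. mat_flat (P i)) ` {..<n}. f x *s x) = 0" and x: "x \<in> (\<lambda>i. mat_flat (P i)) ` {..<n}"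
  then show "f x = 0"
    using combination_unique[of "\<lambda>i. f (mat_flat (P i))"] by (auto simp: sum.reindex[OF inj_flat])
qed simp

lemma card_flat: "card ((\<lambda>i. mat_flat (P i)) ` {..<n}) = n"
  by (simp add: card_image inj_flat)

text \<open>The \<open>n\<close> flattened idempotents are independent, so they span as soon as the
  dimension is \<open>n\<close>.\<close>

lemma commutant_combination:
  assumes "mat_space_dim (commutant S) = n" "M \<in> commutant S"
  obtains c where "\<And>v. M *v v = (\<Sum>i<n. c i *s (P i *v v))"
proof -
  let ?B = "(\<lambda>i. mat_flat (P i)) ` {..<n}"
  have "mat_flat ` commutant S \<subseteq> vec.span ?B"
  proof (rule iffD1[OF vec.card_eq_dim])
    show "?B \<subseteq> mat_flat ` commutant S" using comm by blast
    show "card ?B = vec.dim (mat_flat ` commutant S)"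
      using assms(1) card_flat by (simp add: mat_space_dim_def)
  qed (simp_all add: independent_flat)
  then have "mat_flat M \<in> vec.span ?B" using assms(2) by blast
  then obtain u where "mat_flat M = (\<Sum>x\<in>?B. u x *s x)"
    by (auto simp: vec.span_finite)
  then have "mat_flat M = (\<Sum>i<n. u (mat_flat (P i)) *s mat_flat (P i))"
    by (simp add: sum.reindex[OF inj_flat])
  then show ?thesis by (intro that) (simp add: mat_flat_combination_iff)
qed

lemma mat_space_dim_commutantI:
  assumes "\<And>M. M \<in> commutant S \<Longrightarrow> \<exists>c. \<forall>v. M *v v = (\<Sum>i<n. c i *s (P i *v v))"
  shows "mat_space_dim (commutant S) = n"
proof -
  let ?B = "(\<lambda>i. mat_flat (P i)) ` {..<n}"
  have "mat_flat ` commutant S \<subseteq> vec.span ?B"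
  proof (safe)
    fix M assume "M \<in> commutant S"
    then obtain c where c: "mat_flat M = (\<Sum>i<n. c i *s mat_flat (P i))"
      using assms by (auto simp: mat_flat_combination_iff)
    show "mat_flat M \<in> vec.span ?B"
      unfolding c by (intro vec.span_sum vec.span_scale vec.span_base) simp
  qed
  moreover have "?B \<subseteq> mat_flat ` commutant S" using comm by blast
  ultimately show ?thesis
    unfolding mat_space_dim_def by (rule vec.dim_unique[OF _ _ independent_flat card_flat, rotated])
qed

lemma subrep_range: "i < n \<Longrightarrow> subrep S (range ((*v) (P i)))"
  unfolding subrep_def invariant_def
proof (intro conjI ballI)
  assume i: "i < n"
  show "vec.subspace (range ((*v) (P i)))"
    using vec.linear_subspace_image[OF matrix_vector_mul_linear_gen vec.subspace_UNIV] .
  show "A *v w \<in> range ((*v) (P i))" if "A \<in> S" "w \<in> range ((*v) (P i))" for A w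
    using that(2) by (auto simp: commutantD[OF comm[OF i] that(1), symmetric])
qed

text \<open>The commuting projection onto an invariant \<open>U\<close> is a combination of the
  \<open>P i\<close>, hence a scalar on the range of \<open>P i\<close>. If \<open>U\<close> is
  nonzero, this scalar is 1 because \<open>U\<close> is fixed, and the range lies in
  \<open>U\<close>.\<close>

lemma irreducible_range:
  assumes skew: "\<And>A. A \<in> S \<Longrightarrow> conj_transpose A = - A"
    and dim: "mat_space_dim (commutant S) = n" and i: "i < n"
  shows "irreducible_rep S (range ((*v) (P i)))"
  unfolding irreducible_rep_def
proof (intro conjI allI impI)
  show "range ((*v) (P i)) \<noteq> {0}" using nonzero_vector[OF i] by auto
  fix U assume U: "subrep S U \<and> U \<subseteq> range ((*v) (P i))"
  obtain Q where Q: "Q \<in> commutant S" "\<And>v. Q *v v \<in> U" "\<And>u. u \<in> U \<Longrightarrow> Q *v u = u"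
    using invariant_projection[OF skew, where U = U] U by blast
  obtain c where c: "\<And>v. Q *v v = (\<Sum>i<n. c i *s (P i *v v))"
    using commutant_combination[OF dim Q(1)] by blast
  have Qc: "Q *v v = c i *s v" if "v \<in> range ((*v) (P i))" for v
    using that combination_apply[OF i] c by auto
  show "U = {0} \<or> U = range ((*v) (P i))"
  proof (cases "U = {0}")
    case False
    then obtain u where u: "u \<in> U" "u \<noteq> 0"
      using U vec.subspace_0 by (auto simp: subrep_def)
    then have "(c i - 1) *s u = 0" using Q(3) Qc[of u] U by (auto simp: vec.scale_left_diff_distrib)
    then have "c i = 1" using u by (metis eq_iff_diff_eq_0 vec.scale_eq_0_iff)
    then have "v \<in> U" if "v \<in> range ((*v) (P i))" for v
      using Qc[OF that] Q(2)[of v] by simp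
    then show ?thesis using U by blast
  qed simp
qed (rule subrep_range[OF i])

text \<open>An equivalence \<open>T\<close> composed with \<open>P i\<close> lies in the commutant,
  so it is a scalar on the range of \<open>P i\<close>; its values also lie in the range of
  \<open>P j\<close>. The two ranges meet in 0, contradicting injectivity of
  \<open>T\<close>.\<close>

lemma inequivalent_range:
  assumes dim: "mat_space_dim (commutant S) = n" and ij: "i < n" "j < n" "i \<noteq> j"
  shows "\<not> equivalent_rep S (range ((*v) (P i))) (range ((*v) (P j)))"
proof
  assume "equivalent_rep S (range ((*v) (P i))) (range ((*v) (P j)))"
  then obtain T where lin: "Vector_Spaces.linear (*s) (*s) T"
    and bij: "bij_betw T (range ((*v) (P i))) (range ((*v) (P j)))"
    and T: "\<And>A v. A \<in> S \<Longrightarrow> T (A *v (P i *v v)) = A *v T (P i *v v)"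
    by (auto simp: equivalent_rep_def)
  define Q where "Q = matrix T ** P i"
  have Q: "Q *v v = T (P i *v v)" for v
    using lin by (simp add: Q_def matrix_vector_mul_assoc[symmetric] matrix_works)
  have "Q \<in> commutant S"
    using comm[OF ij(1)] T by (auto intro!: commutantI simp: Q commutantD)
  then obtain c where c: "\<And>v. Q *v v = (\<Sum>i<n. c i *s (P i *v v))"
    using commutant_combination[OF dim] by blast
  obtain v where v: "P i *v v \<noteq> 0" using nonzero_vector ij by blast
  have Tv: "T (P i *v v) = c i *s (P i *v v)"
    using c[of "P i *v v"] combination_apply[OF ij(1), of c v] idem[OF ij(1), of v] by (simp add: Q)
  obtain w where w: "T (P i *v v) = P j *v w" using bij by (metis bij_betwE rangeE rangeI)
  have "P i *v (T (P i *v v)) = T (P i *v v)"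
    by (simp add: Tv vec.scale idem ij)
  then have "T (P i *v v) = 0" using w orth[OF ij] by simp
  moreover have "T (P i *v 0) = 0"
    using lin by (simp add: vec.linear_0)
  ultimately have "P i *v v = P i *v 0"
    using bij by (metis bij_betw_def inj_onD rangeI)
  then show False using v by simp
qed

text \<open>Uniqueness holds because \<open>P j\<close> isolates the \<open>j\<close>-th term of any
  decomposition.\<close>

lemma decomposes_into_range:
  assumes "\<And>i. i < n \<Longrightarrow> irreducible_rep S (Ws i) \<and> Ws i \<subseteq> W"
    and Ws: "\<And>i. i < n \<Longrightarrow> Ws i = range ((*v) (P i))"
    and sum: "\<And>w. w \<in> W \<Longrightarrow> w = (\<Sum>i<n. P i *v w)"
  shows "decomposes_into S W Ws n"
  unfolding decomposes_into_def
proof (intro conjI ballI ex1I)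
  show "\<forall>i<n. irreducible_rep S (Ws i) \<and> Ws i \<subseteq> W" using assms(1) by simp
  fix w assume w: "w \<in> W"
  let ?f = "\<lambda>i. if i < n then P i *v w else 0"
  show "\<forall>i<n. ?f i \<in> Ws i" "\<forall>i\<ge>n. ?f i = 0" "w = sum ?f {..<n}"
    using sum[OF w] by (auto simp: Ws)
  fix f assume f: "(\<forall>i<n. f i \<in> Ws i) \<and> (\<forall>i\<ge>n. f i = 0) \<and> w = sum f {..<n}"
  have "f j = P j *v w" if j: "j < n" for j
  proof -
    have fi: "P j *v f i = (if i = j then f j else 0)" if i: "i < n" for i
    proof -
      obtain u where "f i = P i *v u" using f Ws i by blast
      then show ?thesis using i j by (cases "i = j") (simp_all add: idem orth)
    qed
    have "P j *v w = (\<Sum>i<n. P j *v f i)" using f by (simp add: vec.sum)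
    also have "\<dots> = (\<Sum>i<n. if i = j then f j else 0)" by (intro sum.cong) (simp_all add: fi)
    finally show ?thesis using j by simp
  qed
  then show "f = ?f" using f by (simp add: fun_eq_iff)
qed

end

text \<open>\<open>J U\<close> is the set of indices \<open>k\<close> for which some vector of \<open>U\<close> has its last nonzero component in \<open>Ws k\<close>;
  it plays the role of the composition length.\<close>

lemma decomposes_into_length:
  fixes S :: "(complex^'k^'k) set"
  assumes dec: "decomposes_into S UNIV Ws n"
  obtains J :: "(complex^'k) set \<Rightarrow> nat set" where "\<And>U. J U \<subseteq> {..<n}"
    "\<And>U U'. subrep S U \<Longrightarrow> subrep S U' \<Longrightarrow> U \<subset> U' \<Longrightarrow> J U \<subset> J U'"
proof -
  have irr: "irreducible_rep S (Ws i)" if "i < n" for i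
    using dec that by (simp add: decomposes_into_def)
  have sub: "vec.subspace (Ws i)" if "i < n" for i
    using irr[OF that] by (simp add: irreducible_rep_def subrep_def)
  have inv: "A *v w \<in> Ws i" if "i < n" "A \<in> S" "w \<in> Ws i" for i A w
    using irr[OF that(1)] that by (simp add: irreducible_rep_def subrep_def invariant_def)
  define Q where "Q w f \<longleftrightarrow> (\<forall>i<n. f i \<in> Ws i) \<and> (\<forall>i\<ge>n. f i = 0) \<and> w = (\<Sum>i<n. f i)" for w f
  have ex1: "\<exists>!f. Q w f" for w using dec by (simp add: decomposes_into_def Q_def)
  define c where "c w = (THE f. Q w f)" for w
  have Qc: "Q w (c w)" for w unfolding c_def by (rule theI'[OF ex1])
  have uniq: "c w = f" if "Q w f" for w f using ex1 Qc that by blast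
  have c_add: "c (v + w) = (\<lambda>i. c v i + c w i)" for v w
    using Qc[of v] Qc[of w] sub
    by (intro uniq) (auto simp: Q_def sum.distrib intro: vec.subspace_add)
  have c_scale: "c (a *s v) = (\<lambda>i. a *s c v i)" for a v
    using Qc[of v] sub
    by (intro uniq) (auto simp: Q_def intro: vec.subspace_scale, metis vec.scale_sum_right)
  have c_act: "c (A *v v) = (\<lambda>i. A *v c v i)" if "A \<in> S" for A v
    using Qc[of v] inv[OF _ that]
    by (intro uniq) (auto simp: Q_def, metis vec.sum)
  have c_in: "c v i \<in> Ws i" if "i < n" for v i using Qc that by (simp add: Q_def)
  have c_0: "c 0 = (\<lambda>i. 0)" using c_scale[of 0 0] by simp
  have c_diff: "c (v - w) = (\<lambda>i. c v i - c w i)" for v w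
    using c_add[of v "- w"] c_scale[of "-1" w] by simp
  have c_zero: "v = 0" if "\<And>i. i < n \<Longrightarrow> c v i = 0" for v
    using Qc[of v] that by (simp add: Q_def)
  \<comment> \<open>\<open>L U k\<close> collects the \<open>k\<close>-th components of the vectors
    of \<open>U\<close> whose later components vanish. It is a subrepresentation of the irreducible
    \<open>Ws k\<close> for \<open>k < n\<close>, hence zero or everything.\<close>
  define L where "L U k = {c u k |u. u \<in> U \<and> (\<forall>j. k < j \<and> j < n \<longrightarrow> c u j = 0)}" for U k
  have L_subrep: "subrep S (L U k)" if U: "subrep S U" for U k
    unfolding subrep_def vec.subspace_def invariant_def
  proof (intro conjI ballI allI)
    have sU: "vec.subspace U" and iU: "\<And>A u. A \<in> S \<Longrightarrow> u \<in> U \<Longrightarrow> A *v u \<in> U"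
      using U by (auto simp: subrep_def invariant_def)
    show "0 \<in> L U k" using sU vec.subspace_0 c_0 by (force simp: L_def)
    fix x assume "x \<in> L U k"
    then obtain u where u: "x = c u k" "u \<in> U" "\<And>j. k < j \<Longrightarrow> j < n \<Longrightarrow> c u j = 0"
      by (auto simp: L_def)
    show "a *s x \<in> L U k" for a
      unfolding L_def using u sU by (intro CollectI exI[of _ "a *s u"]) (simp add: c_scale vec.subspace_scale)
    show "A *v x \<in> L U k" if "A \<in> S" for A
      unfolding L_def using u iU that by (intro CollectI exI[of _ "A *v u"]) (simp add: c_act)
    fix y assume "y \<in> L U k"
    then obtain v where v: "y = c v k" "v \<in> U" "\<And>j. k < j \<Longrightarrow> j < n \<Longrightarrow> c v j = 0"
      by (auto simp: L_def)
    show "x + y \<in> L U k"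
      unfolding L_def using u v sU by (intro CollectI exI[of _ "u + v"]) (simp add: c_add vec.subspace_add)
  qed
  define J where "J U = {k. k < n \<and> L U k \<noteq> {0}}" for U
  have L_eq: "L U k = Ws k" if "subrep S U" "k \<in> J U" for U k
  proof -
    have "k < n" "L U k \<noteq> {0}" using that by (auto simp: J_def)
    moreover have "L U k \<subseteq> Ws k" using c_in \<open>k < n\<close> by (auto simp: L_def)
    ultimately show ?thesis using irr[of k] L_subrep[OF that(1), of k] by (auto simp: irreducible_rep_def)
  qed
  have strict: "J U \<subset> J U'" if U: "subrep S U" and U': "subrep S U'" and UU: "U \<subset> U'" for U U'
  proof -
    have L0: "0 \<in> L V k" if "subrep S V" for V k
      using L_subrep[OF that] vec.subspace_0 by (auto simp: subrep_def)
    have "L U k \<subseteq> L U' k" for k using UU by (auto simp: L_def)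
    then have sub: "J U \<subseteq> J U'" using L0[OF U] by (force simp: J_def)
    have "U' \<subseteq> U" if J: "J U' \<subseteq> J U"
    proof -
      \<comment> \<open>Elimination from the top: \<open>m\<close> bounds the nonzero components of
        \<open>u\<close>. If component \<open>m\<close> of the inductive step is nonzero, a vector
        of \<open>U\<close> with the same leading component is subtracted.\<close>
      have "u \<in> U" if "u \<in> U'" "m \<le> n" "\<And>j. m \<le> j \<Longrightarrow> j < n \<Longrightarrow> c u j = 0" for u m
        using that
      proof (induction m arbitrary: u)
        case 0
        then have "u = 0" using c_zero by simp
        then show ?case using U vec.subspace_0 by (auto simp: subrep_def)
      next
        case (Suc m)
        have step: "c u j = 0" if "m < j" "j < n" for j using Suc.prems that by simp
        show ?case
        proof (cases "c u m = 0")
          case True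
          then show ?thesis using Suc.IH[OF Suc.prems(1)] Suc.prems(2) step by (metis Suc_leD le_neq_implies_less)
        next
          case False
          have "c u m \<in> L U' m" using Suc.prems(1) step by (auto simp: L_def)
          with False have "m \<in> J U'" using Suc.prems(2) by (auto simp: J_def)
          then have "m \<in> J U" using J by blast
          have "c u m \<in> L U m" using c_in Suc.prems(2) L_eq[OF U \<open>m \<in> J U\<close>] by auto
          then obtain u' where u': "u' \<in> U" "c u' m = c u m" "\<And>j. m < j \<Longrightarrow> j < n \<Longrightarrow> c u' j = 0"
            by (auto simp: L_def)
          have "u - u' \<in> U'"
            using Suc.prems(1) u'(1) UU U' by (auto simp: subrep_def intro: vec.subspace_diff)
          moreover have "c (u - u') j = 0" if "m \<le> j" "j < n" for j
            using that u' step by (cases "j = m") (simp_all add: c_diff)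
          ultimately have "u - u' \<in> U" using Suc.IH Suc.prems(2) by simp
          then have "(u - u') + u' \<in> U" using u'(1) U by (intro vec.subspace_add) (simp_all add: subrep_def)
          then show ?thesis by simp
        qed
      qed
      then show ?thesis by (meson order_refl not_less subsetI)
    qed
    then show ?thesis using sub UU by blast
  qed
  show ?thesis
  proof (rule that)
    show "J U \<subseteq> {..<n}" for U by (auto simp: J_def)
  qed (rule strict)
qed

section \<open>The tensor square of the standard representation\<close>

text \<open>The index \<open>bar p\<close> is the one paired with \<open>p\<close> by the symplectic form, and the entry of the form
  at \<open>(p, bar p)\<close> is \<open>sg p\<close>.\<close>

definition bar :: "('l::finite) idx \<Rightarrow> 'l idx" where
  "bar p = (\<not> fst p, snd p)"

definition sg :: "('l::finite) idx \<Rightarrow> complex" where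
  "sg p = (if fst p then 1 else -1)"

lemma bar_simps [simp]: "bar (bar p) = p" "bar p \<noteq> p" "p \<noteq> bar p" "bar p = bar q \<longleftrightarrow> p = q"
  by (auto simp: bar_def prod_eq_iff)

lemma bar_eq_swap: "bar p = q \<longleftrightarrow> p = bar q"
  by (metis bar_simps(1))

lemma sg_simps [simp]: "sg (bar p) = - sg p" "sg p * sg p = 1" "sg p * (sg p * x) = x" "sg p \<noteq> 0" "cnj (sg p) = sg p"
  by (auto simp: sg_def bar_def)

lemma sum_bar: "(\<Sum>p\<in>UNIV. f (bar p)) = (\<Sum>p\<in>UNIV. f p)"
  by (rule sum.reindex_bij_witness[of _ bar bar]) auto

lemma sum_if_bar: "(\<Sum>q\<in>UNIV. if p = bar q then f q else 0) = f (bar p)" for f :: "_ \<Rightarrow> complex"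
  by (subst sum_bar[symmetric]) simp

lemma Jmat_nth: "Jmat $ p $ q = (if q = bar p then sg p else 0)"
  by (auto simp: Jmat_def bar_def sg_def prod_eq_iff)

text \<open>As \<open>Jmat\<close> is a signed permutation matrix, the defining equation has no sums
  left and ties each entry to a single reflected one.\<close>

lemma sp_complex_iff:
  "X \<in> sp_complex \<longleftrightarrow> (\<forall>p q. X $ p $ q = - (sg p * sg q * X $ bar q $ bar p))"
proof -
  have "(transpose X ** Jmat + Jmat ** X) $ p $ q = sg p * X $ bar p $ q - sg q * X $ bar q $ p" for p q
    by (simp add: matrix_matrix_mult_def transpose_def Jmat_nth if_distrib if_distribR sum_if_bar cong: if_cong)
  then have "X \<in> sp_complex \<longleftrightarrow> (\<forall>p q. sg p * X $ bar p $ q = sg q * X $ bar q $ p)"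
    by (simp add: sp_complex_def vec_eq_iff)
  also have "\<dots> \<longleftrightarrow> (\<forall>p q. sg (bar p) * X $ bar (bar p) $ q = sg q * X $ bar q $ bar p)"
    by (metis bar_simps(1))
  also have "\<dots> \<longleftrightarrow> (\<forall>p q. X $ p $ q = - (sg p * sg q * X $ bar q $ bar p))"
  proof (intro iff_allI iffI)
    fix p q
    assume "sg (bar p) * X $ bar (bar p) $ q = sg q * X $ bar q $ bar p"
    from arg_cong[OF this, of "\<lambda>x. - sg p * x"]
    show "X $ p $ q = - (sg p * sg q * X $ bar q $ bar p)" by (simp add: mult.assoc)
  next
    fix p q
    assume "X $ p $ q = - (sg p * sg q * X $ bar q $ bar p)"
    from arg_cong[OF this, of "\<lambda>x. - sg p * x"]
    show "sg (bar p) * X $ bar (bar p) $ q = sg q * X $ bar q $ bar p" by (simp add: mult.assoc)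
  qed
  finally show ?thesis .
qed

lemma sp_complexD: "X \<in> sp_complex \<Longrightarrow> X $ p $ q = - (sg p * sg q * X $ bar q $ bar p)"
  using sp_complex_iff by blast

text \<open>The trace condition is automatic, since the diagonal entries at \<open>p\<close> and
  \<open>bar p\<close> are opposite.\<close>

lemma sp_algI:
  assumes X: "X \<in> sp_complex" and skew: "conj_transpose X = - X"
  shows "X \<in> sp_alg"
proof -
  have "trace X = (\<Sum>p\<in>UNIV. - X $ bar p $ bar p)"
    unfolding trace_def by (intro sum.cong refl) (subst sp_complexD[OF X], simp)
  also have "\<dots> = - trace X" by (simp add: trace_def sum_negf sum_bar[of "\<lambda>p. X $ p $ p"])
  finally show ?thesis using assms by (simp add: sp_alg_def su_alg_def)
qed

lemma sp_algD: "X \<in> sp_alg \<Longrightarrow> X \<in> sp_complex" "X \<in> sp_alg \<Longrightarrow> conj_transpose X = - X"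
  by (simp_all add: sp_alg_def su_alg_def)

lemma sum_pair: "(\<Sum>x\<in>UNIV. f x) = (\<Sum>p\<in>UNIV. \<Sum>q\<in>UNIV. f (p, q))"
  for f :: "'a::finite \<times> 'b::finite \<Rightarrow> complex"
  by (simp add: sum.cartesian_product flip: UNIV_Times_UNIV)

lemma tensor_act_nth:
  fixes v :: "('l::finite) tvec"
  shows "(tensor_act X *v v) $ (p, q) = (\<Sum>r\<in>UNIV. X $ p $ r * v $ (r, q)) + (\<Sum>r\<in>UNIV. X $ q $ r * v $ (p, r))"
proof -
  have "(tensor_act X *v v) $ (p, q) = (\<Sum>r\<in>UNIV. \<Sum>s\<in>UNIV. tensor_act X $ (p, q) $ (r, s) * v $ (r, s))"
    by (simp only: matrix_vector_mult_def vec_lambda_beta sum_pair)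
  also have "\<dots> = (\<Sum>r\<in>UNIV. \<Sum>s\<in>UNIV. (if q = s then X $ p $ r * v $ (r, s) else 0))
     + (\<Sum>r\<in>UNIV. \<Sum>s\<in>UNIV. (if p = r then X $ q $ s * v $ (r, s) else 0))"
    unfolding sum.distrib[symmetric]
    by (intro sum.cong refl) (simp add: tensor_act_def distrib_right)
  also have "(\<Sum>r\<in>UNIV. \<Sum>s\<in>UNIV. (if p = r then X $ q $ s * v $ (r, s) else 0))
     = (\<Sum>s\<in>UNIV. \<Sum>r\<in>UNIV. (if p = r then X $ q $ s * v $ (r, s) else 0))"
    by (rule sum.swap)
  finally show ?thesis by simp
qed

lemma tvec_eqI: "(\<And>p q. v $ (p, q) = w $ (p, q)) \<Longrightarrow> v = w" for v w :: "('l::finite) tvec"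
  unfolding vec_eq_iff by (simp add: split_paired_all)

lemma conj_transpose_tensor_act:
  assumes "conj_transpose X = - X" shows "conj_transpose (tensor_act X) = - tensor_act X"
proof -
  have "cnj (X $ q $ p) = - X $ p $ q" for p q
    using arg_cong[OF assms, of "\<lambda>Y. Y $ p $ q"] by (simp add: conj_transpose_def)
  then show ?thesis by (auto simp: vec_eq_iff conj_transpose_def tensor_act_def)
qed

section \<open>The flip, the invariant vector and the three projections\<close>

definition swap :: "('l::finite) tvec \<Rightarrow> 'l tvec" where
  "swap v = (\<chi> x. v $ (snd x, fst x))"

definition omega :: "('l::finite) tvec" where
  "omega = (\<chi> x. if snd x = bar (fst x) then sg (fst x) else 0)"

text \<open>The bilinear pairing with \<open>omega\<close>; it gives the \<open>omega\<close>
  component of a tensor up to the factor \<open>contract omega\<close>.\<close>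

definition contract :: "('l::finite) tvec \<Rightarrow> complex" where
  "contract v = (\<Sum>p\<in>UNIV. sg p * v $ (p, bar p))"

lemma swap_nth [simp]: "swap v $ (p, q) = v $ (q, p)"
  by (simp add: swap_def)

lemma swap_simps [simp]: "swap (v + w) = swap v + swap w" "swap (v - w) = swap v - swap w"
  "swap (c *s v) = c *s swap v" "swap (swap v) = v" "swap 0 = 0"
  by (simp_all add: swap_def vec_eq_iff)

lemma omega_nth: "omega $ (p, q) = (if q = bar p then sg p else 0)"
  by (simp add: omega_def)

lemma swap_omega [simp]: "swap omega = - omega"
  by (auto simp: vec_eq_iff omega_nth)

lemma contract_simps [simp]: "contract (v + w) = contract v + contract w"
  "contract (v - w) = contract v - contract w" "contract (c *s v) = c * contract v" "contract 0 = 0"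
  by (simp_all add: contract_def distrib_left right_diff_distrib sum.distrib sum_subtractf sum_distrib_left mult.left_commute)

lemma contract_swap [simp]: "contract (swap v) = - contract v"
  by (simp add: contract_def sum_bar[of "\<lambda>p. sg p * v $ (bar p, p)", symmetric] sum_negf)

lemma contract_omega [simp]: "contract omega \<noteq> 0"
  by (simp add: contract_def omega_nth)

lemma tensor_act_swap: "tensor_act X *v swap v = swap (tensor_act X *v v)"
  by (auto simp: vec_eq_iff tensor_act_nth)

lemma tensor_act_omega: "X \<in> sp_complex \<Longrightarrow> tensor_act X *v omega = 0"
proof -
  assume X: "X \<in> sp_complex"
  have "(tensor_act X *v omega) $ (p, q) = 0" for p q
    using sp_complexD[OF X, of q "bar p"]
    by (simp add: tensor_act_nth omega_nth if_distrib sum_if_bar cong: if_cong)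
  then show ?thesis by (simp add: vec_eq_iff)
qed

text \<open>Dual to the invariance of \<open>omega\<close>: after reindexing by \<open>bar\<close>,
  the symplectic relation makes the contributions of the two tensor factors cancel.\<close>

lemma contract_tensor_act: "X \<in> sp_complex \<Longrightarrow> contract (tensor_act X *v v) = 0"
proof -
  assume X: "X \<in> sp_complex"
  have "(\<Sum>p\<in>UNIV. \<Sum>r\<in>UNIV. sg p * X $ p $ r * v $ (r, bar p)) =
        (\<Sum>p\<in>UNIV. \<Sum>r\<in>UNIV. - sg p * X $ bar p $ r * v $ (r, p))"
    by (subst sum_bar[symmetric]) simp
  also have "\<dots> = (\<Sum>p\<in>UNIV. \<Sum>r\<in>UNIV. - sg r * X $ bar r $ p * v $ (p, r))"
    by (rule sum.swap)
  also have "\<dots> = (\<Sum>p\<in>UNIV. \<Sum>r\<in>UNIV. - sg p * X $ bar p $ r * v $ (p, r))"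
    by (intro sum.cong refl) (subst sp_complexD[OF X], simp)
  finally show ?thesis
    by (simp add: contract_def tensor_act_nth distrib_left sum.distrib sum_distrib_left sum_negf mult.assoc)
qed

definition sym_proj :: "('l::finite) tmat" where
  "sym_proj = matrix (\<lambda>v. (1/2) *s (v + swap v))"

definition omega_proj :: "('l::finite) tmat" where
  "omega_proj = matrix (\<lambda>v. (contract v / contract (omega :: 'l tvec)) *s omega)"

text \<open>The antisymmetrizer with the line of \<open>omega\<close> removed; its image is the
  antisymmetric tensors of vanishing contraction.\<close>

definition alt_proj :: "('l::finite) tmat" where
  "alt_proj = matrix (\<lambda>v. (1/2) *s (v - swap v)) - omega_proj"

lemma sym_proj: "sym_proj *v v = (1/2) *s (v + swap v)"
  unfolding sym_proj_def
  by (subst matrix_works) (unfold_locales, simp_all add: vec_eq_iff algebra_simps)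

lemma omega_proj: "omega_proj *v (v::('l::finite) tvec) = (contract v / contract (omega :: 'l tvec)) *s omega"
  unfolding omega_proj_def
  by (subst matrix_works) (unfold_locales, simp_all add: vec_eq_iff algebra_simps add_divide_distrib)

lemma alt_proj: "alt_proj *v (v::('l::finite) tvec) = (1/2) *s (v - swap v) - (contract v / contract (omega :: 'l tvec)) *s omega"
  unfolding alt_proj_def matrix_vector_mult_diff_rdistrib omega_proj
  by (subst matrix_works) (unfold_locales, simp_all add: vec_eq_iff algebra_simps)

definition proj :: "nat \<Rightarrow> ('l::finite) tmat" where
  "proj i = (if i = 0 then sym_proj else if i = 1 then alt_proj else omega_proj)"

text \<open>The assumption \<open>l \<ge> 2\<close> takes effect here: there is an index outside the
  symplectic pair of \<open>a\<close>.\<close>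

lemma ex_index_notin:
  assumes "CARD('l::finite) \<ge> 2"
  obtains p where "p \<noteq> a" "p \<noteq> bar (a :: 'l idx)"
proof -
  obtain j where "j \<noteq> snd a"
    using assms by (metis UNIV_I card_2_iff' card_le_Suc0_iff_eq finite not_less_eq_eq numeral_2_eq_2)
  then show ?thesis using that[of "(True, j)"] by (auto simp: bar_def prod_eq_iff)
qed

definition tens :: "complex ^ ('l::finite) idx \<Rightarrow> complex ^ 'l idx \<Rightarrow> 'l tvec" where
  "tens v w = (\<chi> x. v $ fst x * w $ snd x)"

abbreviation unit_vec :: "('l::finite) idx \<Rightarrow> complex ^ 'l idx" where
  "unit_vec p \<equiv> axis p 1"

lemma tens_nth [simp]: "tens v w $ (p, q) = v $ p * w $ q"
  by (simp add: tens_def)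

lemma tens_simps [simp]: "tens (v + v') w = tens v w + tens v' w" "tens v (w + w') = tens v w + tens v w'"
  "tens (v - v') w = tens v w - tens v' w" "tens v (w - w') = tens v w - tens v w'"
  "tens (c *s v) w = c *s tens v w" "tens v (c *s w) = c *s tens v w" "tens 0 w = 0" "tens v 0 = 0"
  by (simp_all add: vec_eq_iff algebra_simps)

lemma swap_tens [simp]: "swap (tens v w) = tens w v"
  by (simp add: vec_eq_iff)

lemma contract_tens_unit: "contract (tens (unit_vec p) (unit_vec q)) = (if q = bar p then sg p else 0)"
proof -
  have "contract (tens (unit_vec p) (unit_vec q)) = (\<Sum>r\<in>UNIV. if p = r then (if q = bar p then sg p else 0) else 0)"
    unfolding contract_def by (intro sum.cong) (auto simp: axis_def)
  then show ?thesis by simp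
qed

lemma tensor_act_tens: "tensor_act X *v tens v w = tens (X *v v) w + tens v (X *v w)"
  by (rule tvec_eqI) (simp add: tensor_act_nth, simp add: matrix_vector_mult_def sum_distrib_left sum_distrib_right
      mult.assoc mult.left_commute)

lemma proj_orthogonal:
  "sym_proj *v (sym_proj *v v) = sym_proj *v v" "alt_proj *v (alt_proj *v v) = alt_proj *v v"
  "omega_proj *v (omega_proj *v v) = omega_proj *v v"
  "sym_proj *v (alt_proj *v v) = 0" "alt_proj *v (sym_proj *v v) = 0"
  "sym_proj *v (omega_proj *v v) = 0" "omega_proj *v (sym_proj *v v) = 0"
  "alt_proj *v (omega_proj *v v) = 0" "omega_proj *v (alt_proj *v v) = 0"
  by (rule tvec_eqI; simp add: sym_proj alt_proj omega_proj field_simps)+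

text \<open>For \<open>l = 1\<close> the antisymmetric tensors are just the line of
  \<open>omega\<close> and \<open>alt_proj\<close> vanishes; an index \<open>p\<close> outside the
  pair of \<open>a\<close> supplies a further antisymmetric tensor.\<close>

lemma proj_nonzero:
  assumes card: "CARD('l::finite) \<ge> 2"
  shows "(sym_proj :: 'l tmat) \<noteq> 0" "(alt_proj :: 'l tmat) \<noteq> 0" "(omega_proj :: 'l tmat) \<noteq> 0"
proof -
  fix a :: "'l idx"
  obtain p where p: "p \<noteq> a" "p \<noteq> bar a" using ex_index_notin[OF card] .
  have "(sym_proj *v tens (unit_vec a) (unit_vec a)) $ (a, a) = 1"
    by (simp add: sym_proj axis_def)
  then show "(sym_proj :: 'l tmat) \<noteq> 0" by auto
  have "(alt_proj *v tens (unit_vec a) (unit_vec p)) $ (a, p) = 1 / 2"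
    using p by (simp add: alt_proj omega_nth, simp add: axis_def)
  then show "(alt_proj :: 'l tmat) \<noteq> 0" by auto
  have "(omega_proj *v omega) $ (a, bar a) = sg a"
    by (simp add: omega_proj omega_nth)
  then show "(omega_proj :: 'l tmat) \<noteq> 0"
    by (metis matrix_vector_mult_0 sg_simps(4) zero_index)
qed

lemma proj_commutant:
  assumes "h \<subseteq> sp_complex"
  shows "sym_proj \<in> commutant (tensor_act ` h)" "alt_proj \<in> commutant (tensor_act ` h)"
    "omega_proj \<in> commutant (tensor_act ` h)"
  using assms
  by (auto intro!: commutantI simp: subset_iff sym_proj alt_proj omega_proj vec.add vec.diff vec.scale
      tensor_act_swap tensor_act_omega contract_tensor_act)

lemma proj_idempotents:
  assumes "h \<subseteq> sp_complex" and "CARD('l::finite) \<ge> 2"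
  shows "invariant_idempotents (tensor_act ` h) (proj :: nat \<Rightarrow> 'l tmat) 3"
proof
  fix i j :: nat and v :: "'l tvec"
  show "i < 3 \<Longrightarrow> (proj i :: 'l tmat) \<in> commutant (tensor_act ` h)"
    by (simp add: proj_def proj_commutant[OF assms(1)])
  show "i < 3 \<Longrightarrow> (proj i :: 'l tmat) *v (proj i *v v) = proj i *v v"
    by (simp add: proj_def proj_orthogonal)
  show "i < 3 \<Longrightarrow> j < 3 \<Longrightarrow> i \<noteq> j \<Longrightarrow> (proj i :: 'l tmat) *v (proj j *v v) = 0"
    by (simp add: proj_def proj_orthogonal)
  show "i < 3 \<Longrightarrow> (proj i :: 'l tmat) \<noteq> 0"
    by (simp add: proj_def proj_nonzero[OF assms(2)])
qed

section \<open>The commutant of the compact symplectic algebra\<close>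

text \<open>Root vectors (and, for \<open>p = q\<close>, Cartan elements) of \<open>sp(2l, C)\<close>; for \<open>q = bar p\<close> the two terms coincide.\<close>

definition gen :: "('l::finite) idx \<Rightarrow> 'l idx \<Rightarrow> 'l sqmat" where
  "gen p q = (\<chi> i j. (if i = p \<and> j = q then 1 else 0) - sg p * sg q * (if i = bar q \<and> j = bar p then 1 else 0))"

lemma gen_sp_complex: "gen p q \<in> sp_complex"
proof -
  have "gen p q $ i $ j = - (sg i * sg j * gen p q $ bar j $ bar i)" for i j
  proof -
    have "sg p * (sg q * (sg p * sg q)) = 1"
      by (metis mult.left_commute mult.right_neutral sg_simps(2))
    then show ?thesis
      by (auto simp: gen_def bar_eq_swap[symmetric] mult.assoc)
  qed
  then show ?thesis unfolding sp_complex_iff by blast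
qed

lemma gen_unit_vec: "gen p q *v unit_vec r =
    (if r = q then unit_vec p else 0) - (sg p * sg q) *s (if r = bar p then unit_vec (bar q) else 0)"
proof -
  have "(gen p q *v unit_vec r) $ i = gen p q $ i $ r" for i
    by (simp add: matrix_vector_mult_def axis_def if_distrib cong: if_cong)
  then show ?thesis by (auto simp: vec_eq_iff gen_def axis_def)
qed

lemma gen_bar_unit_vec: "gen p (bar p) *v unit_vec (bar p) = 2 *s unit_vec p"
  by (simp add: gen_unit_vec vec_eq_iff)

lemma vec_subspace_mult_cancel:
  assumes "vec.subspace K" "(c::complex) *s v \<in> K" "c \<noteq> 0"
  shows "v \<in> K"
  using vec.subspace_scale[OF assms(1,2), of "1 / c"] assms(3) by simp

text \<open>The first factor is moved from \<open>a\<close> to \<open>p\<close>, where the second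
  factor can be changed freely; then the first factor is changed.\<close>

lemma tensor_cyclic:
  fixes K :: "('l::finite) tvec set"
  assumes sub: "vec.subspace K" and inv: "\<And>p q v. v \<in> K \<Longrightarrow> tensor_act (gen p q) *v v \<in> K"
    and a: "tens (unit_vec a) (unit_vec (bar a)) \<in> K"
    and p: "p \<noteq> a" "p \<noteq> bar a"
  shows "K = UNIV"
proof -
  have p': "a \<noteq> bar p" "bar a \<noteq> bar p" "bar a \<noteq> p" "a \<noteq> p" using p by (auto simp: bar_eq_swap)
  note rules = vec.subspace_add[OF sub] vec.subspace_diff[OF sub] vec.subspace_scale[OF sub]
  have A: "tens (unit_vec p) (unit_vec (bar a)) \<in> K"
    using inv[OF a, of p a] p p' by (simp add: tensor_act_tens gen_unit_vec)
  have B: "tens (unit_vec p) (unit_vec s) \<in> K" for s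
  proof (cases "s = a")
    case True
    have "2 *s tens (unit_vec p) (unit_vec a) \<in> K"
      using inv[OF A, of s "bar a"] p p' True by (simp add: tensor_act_tens gen_bar_unit_vec gen_unit_vec[of _ _ p])
    then show ?thesis using vec_subspace_mult_cancel[OF sub] True by simp
  next
    case False
    \<comment> \<open>The unwanted contribution of the first factor. It is nonzero only for
      \<open>p = bar s\<close>, and then it is a multiple of the starting vector.\<close>
    define x where "x = tens (gen s (bar a) *v unit_vec p) (unit_vec (bar a))"
    have "x = (if p = bar s then (sg s * sg a) *s tens (unit_vec a) (unit_vec (bar a)) else 0)"
      using p by (simp add: x_def gen_unit_vec)
    then have x: "x \<in> K" using a rules vec.subspace_0[OF sub] by simp
    have "x + tens (unit_vec p) (unit_vec s) \<in> K"
      using inv[OF A, of s "bar a"] False by (simp add: tensor_act_tens x_def gen_unit_vec[of s "bar a" "bar a"])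
    from rules(2)[OF this x] show ?thesis by simp
  qed
  have B': "tens (unit_vec p) w \<in> K" for w
  proof -
    have "tens (unit_vec p) w = (\<Sum>s\<in>UNIV. w $ s *s tens (unit_vec p) (unit_vec s))"
      by (rule tvec_eqI) (simp add: axis_def if_distrib sum.delta cong: if_cong)
    then show ?thesis by (simp only:) (intro vec.subspace_sum[OF sub] rules(3) B)
  qed
  \<comment> \<open>\<open>gen x p\<close> sends \<open>unit_vec p\<close> to
    \<open>unit_vec x\<close>, or to twice it if \<open>p = bar x\<close>. What it does to the
    second factor leaves a tensor covered by \<open>B'\<close>.\<close>
  have C: "tens (unit_vec x) (unit_vec s) \<in> K" for x s
  proof -
    have "tens (gen x p *v unit_vec p) (unit_vec s) + tens (unit_vec p) (gen x p *v unit_vec s) \<in> K"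
      using inv[OF B[of s], of x p] by (simp add: tensor_act_tens)
    from rules(2)[OF this B'[of "gen x p *v unit_vec s"]]
    have *: "tens (gen x p *v unit_vec p) (unit_vec s) \<in> K" by simp
    show ?thesis
    proof (cases "p = bar x")
      case True
      then have "2 *s tens (unit_vec x) (unit_vec s) \<in> K" using * by (simp add: gen_bar_unit_vec)
      then show ?thesis using vec_subspace_mult_cancel[OF sub] by simp
    next
      case False
      then show ?thesis using * by (simp add: gen_unit_vec)
    qed
  qed
  have "v \<in> K" for v
  proof -
    have v: "v = (\<Sum>x\<in>UNIV. \<Sum>s\<in>UNIV. v $ (x, s) *s tens (unit_vec x) (unit_vec s))"
    proof (rule tvec_eqI)
      fix y z
      have "(\<Sum>s\<in>UNIV. v $ (x, s) * (unit_vec x $ y * unit_vec s $ z)) = (if x = y then v $ (x, z) else 0)" for x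
        by (simp add: axis_def if_distrib cong: if_cong)
      then show "v $ (y, z) = (\<Sum>x\<in>UNIV. \<Sum>s\<in>UNIV. v $ (x, s) *s tens (unit_vec x) (unit_vec s)) $ (y, z)"
        by simp
    qed
    show ?thesis by (subst v) (intro vec.subspace_sum[OF sub] rules(3) C)
  qed
  then show ?thesis by blast
qed

text \<open>The Cartan elements leave only the entries at \<open>(x, bar x)\<close>; the root
  vectors with indices off \<open>a\<close> and \<open>bar a\<close> make these proportional to
  \<open>omega\<close> there. Only the entries at \<open>(a, bar a)\<close> and
  \<open>(bar a, a)\<close> stay free.\<close>

lemma invariant_vector:
  fixes w :: "('l::finite) tvec"
  assumes w: "\<And>p q. tensor_act (gen p q) *v tens (unit_vec a) (unit_vec (bar a)) = 0 \<Longrightarrow> tensor_act (gen p q) *v w = 0"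
    and p: "p \<noteq> a" "p \<noteq> bar a"
  obtains \<alpha> \<beta> c where
    "w = \<alpha> *s tens (unit_vec a) (unit_vec (bar a)) + \<beta> *s tens (unit_vec (bar a)) (unit_vec a) + c *s omega"
proof -
  have H: "tensor_act (gen r r) *v w = 0" for r
    by (rule w) (auto simp: tensor_act_tens gen_unit_vec)
  have diag: "(\<Sum>s\<in>UNIV. gen r r $ x $ s * f s) = ((if x = r then 1 else 0) - (if x = bar r then 1 else 0)) * f x"
    for r x :: "'l idx" and f :: "'l idx \<Rightarrow> complex"
  proof -
    have "(\<Sum>s\<in>UNIV. gen r r $ x $ s * f s) = (\<Sum>s\<in>UNIV. if x = s then ((if x = r then 1 else 0) - (if x = bar r then 1 else 0)) * f x else 0)"
      by (intro sum.cong) (auto simp: gen_def)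
    then show ?thesis by simp
  qed
  \<comment> \<open>\<open>gen x x\<close> multiplies this entry by 2 if \<open>y = x\<close> and by
    1 otherwise.\<close>
  have w0: "w $ (x, y) = 0" if "y \<noteq> bar x" for x y
    using arg_cong[OF H[of x], of "\<lambda>v. v $ (x, y)"] that
    by (auto simp: tensor_act_nth diag split: if_splits)
  have w1: "sg x * w $ (x, bar x) = sg p * w $ (p, bar p)" if x: "x \<noteq> a" "x \<noteq> bar a" for x
  proof -
    have "tensor_act (gen p x) *v w = 0"
      using p x by (intro w) (auto simp: tensor_act_tens gen_unit_vec bar_eq_swap[symmetric])
    from arg_cong[OF this, of "\<lambda>v. v $ (p, bar x)"]
    have e: "(\<Sum>r\<in>UNIV. gen p x $ p $ r * w $ (r, bar x)) + (\<Sum>r\<in>UNIV. gen p x $ bar x $ r * w $ (p, r)) = 0"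
      by (simp add: tensor_act_nth)
    have g: "(\<Sum>r\<in>UNIV. gen p x $ i $ r * f r) = (if i = p then f x else 0) - sg p * sg x * (if i = bar x then f (bar p) else 0)"
      for i and f :: "'l idx \<Rightarrow> complex"
    proof -
      have "(\<Sum>r\<in>UNIV. gen p x $ i $ r * f r) = (\<Sum>r\<in>UNIV. if r = x then if i = p then f x else 0 else 0)
        - (\<Sum>r\<in>UNIV. if r = bar p then sg p * sg x * (if i = bar x then f (bar p) else 0) else 0)"
        unfolding sum_subtractf[symmetric] by (intro sum.cong) (auto simp: gen_def)
      then show ?thesis by simp
    qed
    have "w $ (x, bar x) = sg p * sg x * w $ (p, bar p)"
      using e unfolding g by (cases "p = bar x") (auto simp: add_eq_0_iff2)
    then show ?thesis by simp
  qed
  define c where "c = sg p * w $ (p, bar p)"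
  show ?thesis
  \<comment> \<open>The coefficients at the two free entries are corrected by what
    \<open>c *s omega\<close> already contributes there.\<close>
  proof (rule that[of "w $ (a, bar a) - c * sg a" "w $ (bar a, a) - c * sg (bar a)" c], rule tvec_eqI)
    fix x y
    have "w $ (x, bar x) = c * sg x" if "x \<noteq> a" "x \<noteq> bar a"
      using w1[OF that] by (simp add: c_def[symmetric]) (metis mult.commute sg_simps(3))
    then show "w $ (x, y) = ((w $ (a, bar a) - c * sg a) *s tens (unit_vec a) (unit_vec (bar a)) +
        (w $ (bar a, a) - c * sg (bar a)) *s tens (unit_vec (bar a)) (unit_vec a) + c *s omega) $ (x, y)"
      using w0[of y x] by (cases "y = bar x"; cases "x = a"; cases "x = bar a") (auto simp: omega_nth axis_def)
  qed
qed

text \<open>The real form \<open>sp(l)\<close> has the same commutant as \<open>sp(2l, C) = sp(l) + i sp(l)\<close>.\<close>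

lemma commutant_sp_alg:
  assumes M: "M \<in> commutant (tensor_act ` sp_alg)" and X: "X \<in> sp_complex"
  shows "M *v (tensor_act X *v v) = tensor_act X *v (M *v v)"
proof -
  \<comment> \<open>\<open>X = A + \<i> B\<close> with \<open>A\<close> and \<open>B\<close>
    skew-Hermitian; both stay symplectic because the signs in the symplectic relation are
    real.\<close>
  define A where "A = (\<chi> p q. (X $ p $ q - cnj (X $ q $ p)) / 2)"
  define B where "B = (\<chi> p q. (X $ p $ q + cnj (X $ q $ p)) / (2 * \<i>))"
  have cX: "cnj (X $ q $ p) = - (sg p * sg q * cnj (X $ bar p $ bar q))" for p q
    by (subst sp_complexD[OF X]) (simp add: mult.commute)
  have "A \<in> sp_complex" unfolding sp_complex_iff A_def vec_lambda_beta
  proof (intro allI)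
    fix p q
    show "(X $ p $ q - cnj (X $ q $ p)) / 2 = - (sg p * sg q * ((X $ bar q $ bar p - cnj (X $ bar p $ bar q)) / 2))"
      using sp_complexD[OF X, of p q] cX[of q p] by (simp add: algebra_simps diff_divide_distrib)
  qed
  moreover have "conj_transpose A = - A"
    by (simp add: vec_eq_iff conj_transpose_def A_def field_simps)
  ultimately have A: "A \<in> sp_alg" by (rule sp_algI)
  have "B \<in> sp_complex" unfolding sp_complex_iff B_def vec_lambda_beta
  proof (intro allI)
    fix p q
    show "(X $ p $ q + cnj (X $ q $ p)) / (2 * \<i>) = - (sg p * sg q * ((X $ bar q $ bar p + cnj (X $ bar p $ bar q)) / (2 * \<i>)))"
      using sp_complexD[OF X, of p q] cX[of q p] by (simp add: algebra_simps add_divide_distrib diff_divide_distrib)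
  qed
  moreover have "conj_transpose B = - B"
    by (simp add: vec_eq_iff conj_transpose_def B_def field_simps)
  ultimately have B: "B \<in> sp_alg" by (rule sp_algI)
  have "X $ p $ q = A $ p $ q + \<i> * B $ p $ q" for p q
    by (simp add: A_def B_def field_simps)
  then have "tensor_act X *v v = tensor_act A *v v + \<i> *s (tensor_act B *v v)" for v
    by (intro tvec_eqI) (simp add: tensor_act_nth distrib_left distrib_right sum.distrib sum_distrib_left mult.assoc)
  then show ?thesis
    using commutantD[OF M imageI[OF A]] commutantD[OF M imageI[OF B]] by (simp add: vec.add vec.scale)
qed

lemma mat_space_dim_commutant_sp_alg:
  assumes card: "CARD('l::finite) \<ge> 2"
  shows "mat_space_dim (commutant (tensor_act ` (sp_alg :: 'l sqmat set))) = 3"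
proof -
  interpret invariant_idempotents "tensor_act ` (sp_alg :: 'l sqmat set)" proj 3
    using card by (intro proj_idempotents) (auto simp: sp_algD)
  show ?thesis
  proof (rule mat_space_dim_commutantI)
    fix M :: "'l tmat" assume M: "M \<in> commutant (tensor_act ` sp_alg)"
    fix a :: "'l idx"
    let ?u = "tens (unit_vec a) (unit_vec (bar a))"
    obtain p where p: "p \<noteq> a" "p \<noteq> bar a" using ex_index_notin[OF card] .
    have comm: "M *v (tensor_act (gen p q) *v v) = tensor_act (gen p q) *v (M *v v)" for p q v
      by (rule commutant_sp_alg[OF M gen_sp_complex])
    have "tensor_act (gen p q) *v (M *v ?u) = 0" if "tensor_act (gen p q) *v ?u = 0" for p q
      using comm[of p q ?u] that by simp
    then obtain \<alpha> \<beta> c where c: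
      "M *v ?u = \<alpha> *s ?u + \<beta> *s tens (unit_vec (bar a)) (unit_vec a) + c *s omega"
      using invariant_vector[OF _ p] by metis
    \<comment> \<open>A map commuting with all generators and agreeing with \<open>M\<close> at the
      cyclic vector \<open>?u\<close>; the factor \<open>sg a\<close> compensates
      \<open>contract ?u = sg a\<close>.\<close>
    define F where "F v = \<alpha> *s v + \<beta> *s swap v + (c * sg a * contract v) *s omega" for v :: "'l tvec"
    have "{v. M *v v = F v} = UNIV"
    proof (rule tensor_cyclic[OF _ _ _ p])
      have "F (v + w) = F v + F w" "F (r *s v) = r *s F v" "F 0 = 0" for v w r
        by (simp_all add: F_def vec_eq_iff algebra_simps)
      then show "vec.subspace {v. M *v v = F v}"
        by (auto simp: vec.subspace_def vec.add vec.scale)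
      show "tensor_act (gen p q) *v v \<in> {v. M *v v = F v}" if "v \<in> {v. M *v v = F v}" for p q v
        using that by (simp add: comm F_def vec.add vec.scale tensor_act_swap tensor_act_omega
            contract_tensor_act gen_sp_complex)
      show "?u \<in> {v. M *v v = F v}"
        by (simp add: c F_def contract_tens_unit mult.assoc)
    qed
    then have MF: "M *v v = F v" for v by blast
    \<comment> \<open>The scalars by which \<open>F\<close> acts on the three images: the flip is 1
      on the first and -1 on the others, and the contraction vanishes off
      \<open>omega\<close>.\<close>
    define d where "d i = (if i = 0 then \<alpha> + \<beta> else if i = 1 then \<alpha> - \<beta>
      else \<alpha> - \<beta> + c * sg a * contract (omega :: 'l tvec))" for i :: nat
    have "M *v v = (\<Sum>i<3. d i *s (proj i *v v))" for v
      unfolding MF F_def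
      by (rule tvec_eqI) (simp add: numeral_3_eq_3 d_def proj_def sym_proj alt_proj omega_proj field_simps)
    then show "\<exists>d. \<forall>v. M *v v = (\<Sum>i<3. d i *s (proj i *v v))" by blast
  qed
qed

section \<open>The symmetric square as the adjoint representation\<close>

text \<open>The matrix \<open>X J^{-1}\<close> read as a tensor, where \<open>J\<close> is
  \<open>Jmat\<close>; the symplectic relation for \<open>X\<close> becomes symmetry of this
  tensor.\<close>

definition sym_of_mat :: "('l::finite) sqmat \<Rightarrow> 'l tvec" where
  "sym_of_mat X = (\<chi> x. sg (snd x) * X $ fst x $ bar (snd x))"

lemma sym_of_mat_nth: "sym_of_mat X $ (p, q) = sg q * X $ p $ bar q"
  by (simp add: sym_of_mat_def)

lemma sym_of_mat_linear: "sym_of_mat (X + Y) = sym_of_mat X + sym_of_mat Y"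
  "sym_of_mat (mat_scale c X) = c *s sym_of_mat X" "sym_of_mat 0 = 0"
  by (simp_all add: vec_eq_iff sym_of_mat_def mat_scale_def distrib_left mult.left_commute)

lemma sym_of_mat_inj: "sym_of_mat X = sym_of_mat Y \<Longrightarrow> X = Y"
proof -
  assume a: "sym_of_mat X = sym_of_mat Y"
  have "X $ p $ q = Y $ p $ q" for p q
    using arg_cong[OF a, of "\<lambda>v. v $ (p, bar q)"] by (simp add: sym_of_mat_nth)
  then show ?thesis by (simp add: vec_eq_iff)
qed

lemma sym_of_mat_in_sym_space: "X \<in> sp_complex \<Longrightarrow> sym_of_mat X \<in> sym_space"
proof -
  assume X: "X \<in> sp_complex"
  have "sg q * X $ p $ bar q = sg p * X $ q $ bar p" for p q
    by (subst sp_complexD[OF X]) (simp add: mult.commute mult.left_commute)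
  then show ?thesis by (simp add: sym_space_def sym_of_mat_nth)
qed

text \<open>With \<open>T\<close> for transpose, the left side is
  \<open>A X J^{-1} + X J^{-1} A^T\<close>, and \<open>J^{-1} A^T = - A J^{-1}\<close> for
  symplectic \<open>A\<close>.\<close>

lemma tensor_act_sym_of_mat:
  assumes A: "A \<in> sp_complex"
  shows "tensor_act A *v sym_of_mat X = sym_of_mat (lie_bracket A X)"
proof (rule tvec_eqI)
  fix p q
  have "(\<Sum>r\<in>UNIV. A $ q $ r * (sg r * X $ p $ bar r)) = (\<Sum>r\<in>UNIV. A $ q $ bar r * (sg (bar r) * X $ p $ r))"
    by (subst sum_bar[symmetric]) simp
  also have "\<dots> = - (sg q * (\<Sum>r\<in>UNIV. X $ p $ r * A $ r $ bar q))"
    unfolding sum_distrib_left sum_negf[symmetric]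
    by (intro sum.cong refl) (subst sp_complexD[OF A], simp add: mult.commute mult.left_commute)
  finally show "(tensor_act A *v sym_of_mat X) $ (p, q) = sym_of_mat (lie_bracket A X) $ (p, q)"
    by (simp add: tensor_act_nth sym_of_mat_nth lie_bracket_def matrix_matrix_mult_def
        sum_distrib_left right_diff_distrib mult.left_commute)
qed

lemma subspace_sym_space: "vec.subspace (sym_space :: ('l::finite) tvec set)"
  by (simp add: vec.subspace_def sym_space_def)

lemma irreducible_sym_imp_sp_alg:
  fixes h :: "('l::finite) sqmat set"
  assumes h: "lie_subalgebra h" and irr: "irreducible_rep (tensor_act ` h) sym_space"
  shows "h = sp_alg"
proof -
  have hsp: "h \<subseteq> sp_alg" and h0: "0 \<in> h" and hadd: "\<And>X Y. X \<in> h \<Longrightarrow> Y \<in> h \<Longrightarrow> X + Y \<in> h"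
    and hscale: "\<And>r X. X \<in> h \<Longrightarrow> mat_scale (complex_of_real r) X \<in> h"
    and hbr: "\<And>X Y. X \<in> h \<Longrightarrow> Y \<in> h \<Longrightarrow> lie_bracket X Y \<in> h"
    using h by (auto simp: lie_subalgebra_def)
  have hC: "X \<in> sp_complex" if "X \<in> h" for X using that hsp by (auto dest: sp_algD)
  \<comment> \<open>The image of \<open>h + ih\<close> in the symmetric square.\<close>
  define U where "U = {sym_of_mat X + \<i> *s sym_of_mat Y |X Y. X \<in> h \<and> Y \<in> h}"
  have UI: "sym_of_mat X + \<i> *s sym_of_mat Y \<in> U" if "X \<in> h" "Y \<in> h" for X Y
    using that by (auto simp: U_def)
  have "subrep (tensor_act ` h) U"
    unfolding subrep_def invariant_def vec.subspace_def
  proof (intro conjI ballI allI)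
    show "0 \<in> U" using UI[OF h0 h0] by (simp add: sym_of_mat_linear)
    fix x assume "x \<in> U"
    then obtain X Y where x: "x = sym_of_mat X + \<i> *s sym_of_mat Y" and XY: "X \<in> h" "Y \<in> h" by (auto simp: U_def)
    show "c *s x \<in> U" for c
    proof -
      have "c *s x = sym_of_mat (mat_scale (complex_of_real (Re c)) X + mat_scale (complex_of_real (- Im c)) Y)
        + \<i> *s sym_of_mat (mat_scale (complex_of_real (Im c)) X + mat_scale (complex_of_real (Re c)) Y)"
        unfolding x sym_of_mat_linear
        by (subst complex_eq[of c]) (simp add: vec_eq_iff algebra_simps)
      then show ?thesis using UI hadd hscale XY by metis
    qed
    show "T *v x \<in> U" if "T \<in> tensor_act ` h" for T
      using that UI hbr XY by (auto simp: x vec.add vec.scale tensor_act_sym_of_mat hC)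
    fix y assume "y \<in> U"
    then obtain X' Y' where y: "y = sym_of_mat X' + \<i> *s sym_of_mat Y'" and XY': "X' \<in> h" "Y' \<in> h" by (auto simp: U_def)
    have "x + y = sym_of_mat (X + X') + \<i> *s sym_of_mat (Y + Y')"
      by (simp add: x y sym_of_mat_linear vec_eq_iff algebra_simps)
    then show "x + y \<in> U" using UI hadd XY XY' by simp
  qed
  moreover have "U \<subseteq> sym_space"
    using sym_of_mat_in_sym_space[OF hC] subspace_sym_space
    by (auto simp: U_def intro!: vec.subspace_add vec.subspace_scale)
  ultimately have "U = {0} \<or> U = sym_space" using irr by (simp add: irreducible_rep_def)
  then show ?thesis
  proof
    \<comment> \<open>Then \<open>h\<close> is zero and every subspace is invariant, but the
      symmetric square contains two independent tensors \<open>?e\<close> and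
      \<open>?f\<close>.\<close>
    assume "U = {0}"
    then have h_eq: "h = {0}"
      using UI[OF _ h0] h0 sym_of_mat_inj[of _ 0] by (fastforce simp: sym_of_mat_linear)
    fix i :: 'l
    let ?e = "tens (unit_vec (True, i)) (unit_vec (True, i))" and ?f = "tens (unit_vec (False, i)) (unit_vec (False, i))"
    have "tensor_act 0 = (0 :: 'l tmat)" by (simp add: tensor_act_def vec_eq_iff)
    then have "subrep (tensor_act ` h) (vec.span {?e})"
      by (auto simp: h_eq subrep_def invariant_def vec.span_zero)
    moreover have "?e \<in> sym_space" "?f \<in> sym_space" by (auto simp: sym_space_def)
    moreover have "vec.span {?e} \<subseteq> sym_space"
      using \<open>?e \<in> sym_space\<close> subspace_sym_space by (intro vec.span_minimal) auto
    moreover have "?e \<in> vec.span {?e}" by (simp add: vec.span_base)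
    moreover have e: "?e $ ((True, i), (True, i)) = 1" by (simp add: axis_def)
    then have "?e \<noteq> 0" by (metis zero_index zero_neq_one)
    ultimately have "vec.span {?e} = sym_space" using irr unfolding irreducible_rep_def by blast
    then have "?f \<in> vec.span {?e}" using \<open>?f \<in> sym_space\<close> by simp
    then obtain k where k: "?f = k *s ?e" by (auto simp: vec.span_singleton)
    have "?f $ ((False, i), (False, i)) = 1" "?e $ ((False, i), (False, i)) = 0" by (simp_all add: axis_def)
    then show ?thesis using k by (metis mult_zero_right vector_smult_component zero_neq_one)
  next
    assume U: "U = sym_space"
    have "X \<in> h" if X: "X \<in> sp_alg" for X
    proof -
      have "sym_of_mat X \<in> U" using X U sym_of_mat_in_sym_space sp_algD by blast
      then obtain A B where AB: "A \<in> h" "B \<in> h" and "sym_of_mat X = sym_of_mat A + \<i> *s sym_of_mat B"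
        by (auto simp: U_def)
      then have XAB: "X = A + mat_scale \<i> B"
        by (intro sym_of_mat_inj) (simp add: sym_of_mat_linear)
      have skew: "cnj (Y $ q $ p) = - Y $ p $ q" if "Y \<in> sp_alg" for Y :: "'l sqmat" and p q
        using arg_cong[OF sp_algD(2)[OF that], of "\<lambda>Z. Z $ p $ q"] by (simp add: conj_transpose_def)
      \<comment> \<open>\<open>X - A\<close> is skew-Hermitian, whereas \<open>\<i> B\<close> is
        Hermitian.\<close>
      have "B $ p $ q = 0" for p q
        using skew[OF X, of q p] skew[of A q p] skew[of B q p] AB hsp
        by (simp add: XAB mat_scale_def subset_iff)
      then have "X = A" by (simp add: XAB mat_scale_def vec_eq_iff)
      then show ?thesis using AB by simp
    qed
    then show ?thesis using hsp by blast
  qed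
qed

section \<open>Images of the projections and the equivalences\<close>

lemma sym_spaceD: "v \<in> sym_space \<Longrightarrow> v $ (p, q) = v $ (q, p)"
  unfolding sym_space_def by blast

lemma alt_space_nth: "v \<in> alt_space \<Longrightarrow> v $ (p, q) = - v $ (q, p)"
  unfolding alt_space_def by blast

lemma sym_space_eq: "sym_space = range ((*v) sym_proj)"
proof (intro equalityI subsetI)
  fix v :: "'a tvec" assume "v \<in> sym_space"
  have "v = sym_proj *v v"
  proof (rule tvec_eqI)
    fix p q
    have "v $ (q, p) = v $ (p, q)" using \<open>v \<in> sym_space\<close> by (rule sym_spaceD)
    then show "v $ (p, q) = (sym_proj *v v) $ (p, q)" by (simp add: sym_proj)
  qed
  then show "v \<in> range ((*v) sym_proj)" by (metis rangeI)
qed (auto simp: sym_proj sym_space_def)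

lemma alt_spaceD: "v \<in> alt_space \<Longrightarrow> v = alt_proj *v v + omega_proj *v v"
proof (rule tvec_eqI)
  fix p q assume "v \<in> alt_space"
  then have "v $ (q, p) = - v $ (p, q)" by (rule alt_space_nth)
  then show "v $ (p, q) = (alt_proj *v v + omega_proj *v v) $ (p, q)"
    by (simp add: alt_proj omega_proj)
qed

lemma alt_space_proj: "alt_proj *v v \<in> alt_space" "omega_proj *v v \<in> alt_space"
proof -
  have omega: "omega $ (p, q) = - omega $ (q, p)" for p q :: "'a idx"
    by (metis swap_nth swap_omega vector_uminus_component)
  show "alt_proj *v v \<in> alt_space" unfolding alt_space_def
  proof (intro CollectI allI)
    show "(alt_proj *v v) $ (p, q) = - (alt_proj *v v) $ (q, p)" for p q
      by (subst (1 2) alt_proj) (simp add: omega[of q p] right_diff_distrib)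
  qed
  show "omega_proj *v v \<in> alt_space" unfolding alt_space_def
  proof (intro CollectI allI)
    show "(omega_proj *v v) $ (p, q) = - (omega_proj *v v) $ (q, p)" for p q
      by (subst (1 2) omega_proj) (simp add: omega[of q p])
  qed
qed

lemma proj_sum: "v = (\<Sum>i<3. proj i *v v)"
proof -
  have "v = sym_proj *v v + alt_proj *v v + omega_proj *v v"
    unfolding sym_proj alt_proj omega_proj
    by (rule tvec_eqI) (simp add: right_diff_distrib distrib_left)
  then show ?thesis by (simp add: numeral_3_eq_3 proj_def)
qed

lemma three_irreducibles_imp_irreducible_sym:
  fixes h :: "('l::finite) sqmat set"
  assumes card: "CARD('l) \<ge> 2" and h: "h \<subseteq> sp_complex" and dec: "decomposes_into (tensor_act ` h) UNIV Ws 3"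
  shows "irreducible_rep (tensor_act ` h) sym_space"
proof -
  let ?S = "tensor_act ` h"
  interpret invariant_idempotents ?S proj 3 using h card by (intro proj_idempotents)
  obtain J :: "'l tvec set \<Rightarrow> nat set" where J: "\<And>U. J U \<subseteq> {..<3}"
    and strict: "\<And>U U'. subrep ?S U \<Longrightarrow> subrep ?S U' \<Longrightarrow> U \<subset> U' \<Longrightarrow> J U \<subset> J U'"
    using decomposes_into_length[OF dec] by blast
  have card_less: "card (J U) < card (J U')" if "subrep ?S U" "subrep ?S U'" "U \<subset> U'" for U U'
    using strict[OF that] J by (meson finite_lessThan finite_subset psubset_card_mono)
  have sym: "subrep ?S sym_space" using subrep_range[of 0] by (simp add: proj_def sym_space_eq)
  \<comment> \<open>The kernel of \<open>alt_proj\<close> is the sum of the symmetric square and the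
    line of \<open>omega\<close>.\<close>
  define K where "K = {v. alt_proj *v v = (0 :: 'l tvec)}"
  have K: "subrep ?S K"
    using commutantD[OF proj_commutant(2)[OF h]]
    by (auto simp: K_def subrep_def invariant_def vec.subspace_def vec.add vec.scale)
  have full: "subrep ?S UNIV" and zero: "subrep ?S {0}"
    by (auto simp: subrep_def invariant_def vec.subspace_UNIV)
  have "alt_proj *v omega = (0 :: 'l tvec)"
    by (rule tvec_eqI) (simp add: alt_proj)
  then have "omega \<in> K" by (simp add: K_def)
  moreover have "(omega :: 'l tvec) \<notin> sym_space"
  proof
    fix a :: "'l idx" assume "(omega :: 'l tvec) \<in> sym_space"
    from sym_spaceD[OF this, of a "bar a"] show False by (simp add: omega_nth)
  qed
  moreover have "sym_space \<subseteq> K" by (auto simp: sym_space_eq K_def proj_orthogonal)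
  ultimately have sK: "sym_space \<subset> K" by blast
  have KU: "K \<subset> UNIV" using nonzero_vector[of 1] by (auto simp: K_def proj_def)
  obtain v where "sym_proj *v v \<noteq> (0 :: 'l tvec)" using nonzero_vector[of 0] by (auto simp: proj_def)
  then have "sym_space \<noteq> {0 :: 'l tvec}" unfolding sym_space_eq by blast
  moreover have "U = {0} \<or> U = sym_space" if U: "subrep ?S U" "U \<subseteq> sym_space" for U
  proof (rule ccontr)
    assume "\<not> ?thesis"
    moreover have "0 \<in> U" using U vec.subspace_0 by (auto simp: subrep_def)
    ultimately have "{0} \<subset> U" "U \<subset> sym_space" using U by auto
    \<comment> \<open>With \<open>U\<close> inserted, the chain up to \<open>UNIV\<close> has four
      strict steps, although \<open>J\<close> takes values in the subsets of a three-element
      set.\<close>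
    then have "card (J {0}) < card (J U)" "card (J U) < card (J sym_space)"
      using card_less zero U(1) sym by auto
    moreover have "card (J sym_space) < card (J K)" "card (J K) < card (J UNIV)"
      using card_less sym K full sK KU by auto
    moreover have "card (J UNIV) \<le> 3" using card_mono[OF finite_lessThan J[of UNIV]] by simp
    ultimately show False by linarith
  qed
  ultimately show ?thesis using sym by (simp add: irreducible_rep_def)
qed


lemma skew_tensor_act: "h \<subseteq> sp_alg \<Longrightarrow> A \<in> tensor_act ` h \<Longrightarrow> conj_transpose A = - A"
  by (auto simp: conj_transpose_tensor_act sp_algD)

theorem theorem4:
  fixes h :: "('l::finite) sqmat set"
  assumes "CARD('l) \<ge> 2"
    and "lie_subalgebra h"
  shows "(h = sp_alg \<longleftrightarrow> irreducible_rep (tensor_act ` h) sym_space)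
       \<and> (h = sp_alg \<longleftrightarrow>
            (irreducible_rep (tensor_act ` h) sym_space
             \<and> (\<exists>W1 W2. decomposes_into (tensor_act ` h) alt_space (\<lambda>i. if i = 0 then W1 else W2) 2
                 \<and> pairwise_inequivalent (tensor_act ` h)
                      (\<lambda>i. if i = 0 then sym_space else if i = 1 then W1 else W2) 3)))
       \<and> (h = sp_alg \<longleftrightarrow>
            (\<exists>Ws. decomposes_into (tensor_act ` h) UNIV Ws 3
                 \<and> pairwise_inequivalent (tensor_act ` h) Ws 3))
       \<and> (h = sp_alg \<longleftrightarrow> mat_space_dim (commutant (tensor_act ` h)) = 3)"
    (is "(?a \<longleftrightarrow> ?b) \<and> (?a \<longleftrightarrow> ?c) \<and> (?a \<longleftrightarrow> ?d) \<and> (?a \<longleftrightarrow> ?e)")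
proof -
  let ?S = "tensor_act ` h"
  have h: "h \<subseteq> sp_alg" using assms(2) by (simp add: lie_subalgebra_def)
  then have hC: "h \<subseteq> sp_complex" using sp_algD by blast
  interpret invariant_idempotents ?S proj 3
    using hC assms(1) by (rule proj_idempotents)
  have ba: "?b \<Longrightarrow> ?a" by (rule irreducible_sym_imp_sp_alg[OF assms(2)])
  have ae: "?a \<Longrightarrow> ?e" using mat_space_dim_commutant_sp_alg[OF assms(1)] by simp
  have db: "?d \<Longrightarrow> ?b" using three_irreducibles_imp_irreducible_sym[OF assms(1) hC] by blast
  \<comment> \<open>This closes the circle: (a) gives (e), (e) gives (b), (c) and (d), each of (c)
    and (d) gives (b), and (b) gives (a).\<close>
  have "?b \<and> ?c \<and> ?d" if e: ?e
  proof -
    let ?Ws = "\<lambda>i. range ((*v) (proj i :: 'l tmat))"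
    have irr: "irreducible_rep ?S (?Ws i)" if "i < 3" for i :: nat
      using irreducible_range[OF skew_tensor_act[OF h] e that] .
    have ineq: "pairwise_inequivalent ?S ?Ws 3"
      using inequivalent_range[OF e] by (simp add: pairwise_inequivalent_def)
    have b: ?b using irr[of 0] by (simp add: proj_def sym_space_eq)
    have "decomposes_into ?S UNIV ?Ws 3"
      by (rule decomposes_into_range) (simp_all add: irr flip: proj_sum)
    then have d: ?d using ineq by blast
    \<comment> \<open>For (c) the locale is used again with the two antisymmetric projections, which
      sum to the identity on \<open>alt_space\<close>.\<close>
    let ?Q = "\<lambda>i::nat. if i = 0 then alt_proj else omega_proj :: 'l tmat"
    interpret alt: invariant_idempotents ?S ?Q 2
      by unfold_locales (auto simp: proj_commutant[OF hC] proj_nonzero[OF assms(1)] proj_orthogonal)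
    have "decomposes_into ?S alt_space (\<lambda>i. if i = 0 then ?Ws 1 else ?Ws 2) 2"
    proof (rule alt.decomposes_into_range)
      show "irreducible_rep ?S (if i = 0 then ?Ws 1 else ?Ws 2) \<and> (if i = 0 then ?Ws 1 else ?Ws 2) \<subseteq> alt_space"
        for i :: nat
        using irr[of 1] irr[of 2] by (auto simp: proj_def alt_space_proj)
      show "(if i = 0 then ?Ws 1 else ?Ws 2) = range ((*v) (?Q i))" for i :: nat
        by (simp add: proj_def)
      show "w = (\<Sum>i<2. ?Q i *v w)" if "w \<in> alt_space" for w
        using alt_spaceD[OF that] by (simp add: numeral_2_eq_2)
    qed
    moreover have "pairwise_inequivalent ?S (\<lambda>i. if i = 0 then sym_space else if i = 1 then ?Ws 1 else ?Ws 2) 3"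
    proof -
      have "(\<lambda>i::nat. if i = 0 then sym_space else if i = 1 then ?Ws 1 else ?Ws 2) = ?Ws"
        by (auto simp: fun_eq_iff proj_def sym_space_eq)
      with ineq show ?thesis by simp
    qed
    ultimately have ?c using b by blast
    then show ?thesis using b d by blast
  qed
  then show ?thesis using ba ae db by blast
qed

end
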